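(* Consider the CTH-RV car-following system with parameter vector $\theta=(k_1,k_2,\tau)$, $k_1,k_2\ge 0$, initial condition $x_0=(s_0,v_0)$ and scalar input $u$: $$\dot s(t)=u(t)-v(t),\qquad \dot v(t)=k_1\bigl(s(t)-\tau v(t)\bigr)+k_2\bigl(u(t)-v(t)\bigr),\qquad s(0)=s_0,\ v(0)=v_0,$$ with output $y(t,\theta,x_0,u)=s(t)$. This system is structurally locally identifiable under almost all initial conditions $x_0$ and an admissible input $u(t)$ of degree $n\ge 0$, up to a set of measure zero. Here structural local identifiability means: for almost all $\theta$ there exists a neighborhood $\mathcal N(\theta)$ of $\theta$ such that, for all $\theta_1,\theta_2\in\mathcal N(\theta)$, the implication $$\bigl(y(t,\theta_1,x_0,u)=y(t,\theta_2,x_0,u)\ \text{ for all } t>0\bigr)\ \Longrightarrow\ \theta_1=\theta_2$$ holds for almost all $x_0$ and every input $u\in\mathcal U$, where $\mathcal U$ is the set of admissible inputs, here the polynomial inputs of degree $n\ge 0$ (so constant inputs $u(t)=u_0$ are already admissible).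
   Context: The CTH-RV (constant-time headway relative-velocity) model describes a vehicle following a leader: $s$ is the space gap, $v$ the follower's velocity, and the input $u$ the leader's velocity. The gains $k_1,k_2$ are non-negative and $\tau$ is the constant time headway; the parameters do not vary in time. Only the space gap is measured. "Almost all" means outside a set of measure zero. Admissible inputs are polynomial inputs in $t$ that enable structural identifiability; the degree $n$ of an input is its number of non-zero time derivatives, so degree $0$ means a constant input $u(t)=u_0$.
   Formalization: The zero input u=0 is excluded, since for it only k1 and k1τ+k2 affect the output and the claim fails; "for almost all x_0 and every input u" is read as: for every u, for almost all x_0 (the exceptional null set may depend on θ_1, θ_2 and u). *)

theory Defs
  imports "HOL-Analysis.Analysis" "HOL-Computational_Algebra.Polynomial"
begin

definition cth_rv_parameters :: "(real \<times> real \<times> real) set" where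
  "cth_rv_parameters = {(k1, k2, \<tau>). 0 \<le> k1 \<and> 0 \<le> k2}"

text \<open>The system is posed on times \<open>t \<ge> 0\<close>, with the one-sided derivative at \<open>t = 0\<close>;
  the values of \<open>s\<close> and \<open>v\<close> at negative times are irrelevant.\<close>

definition cth_rv_solution ::
    "real \<times> real \<times> real \<Rightarrow> real \<times> real \<Rightarrow> (real \<Rightarrow> real) \<Rightarrow> (real \<Rightarrow> real) \<Rightarrow> (real \<Rightarrow> real) \<Rightarrow> bool"
  where
  "cth_rv_solution = (\<lambda>(k1, k2, \<tau>) (s0, v0) u s v.
     s 0 = s0 \<and> v 0 = v0 \<and>
     (\<forall>t\<ge>0. (s has_real_derivative u t - v t) (at t within {0..}) \<and>
            (v has_real_derivative k1 * (s t - \<tau> * v t) + k2 * (u t - v t)) (at t within {0..})))"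

text \<open>By \<open>cth_rv_solution_exists\<close> and \<open>cth_rv_solution_unique\<close> below, the description in the
  following definition denotes the value of a unique solution for \<open>t \<ge> 0\<close> and continuous
  \<open>u\<close>. For \<open>t < 0\<close> it is meaningless.\<close>

definition cth_rv_output ::
    "real \<Rightarrow> real \<times> real \<times> real \<Rightarrow> real \<times> real \<Rightarrow> (real \<Rightarrow> real) \<Rightarrow> real" where
  "cth_rv_output t \<theta> x0 u = (THE y. \<exists>s v. cth_rv_solution \<theta> x0 u s v \<and> y = s t)"

text \<open>For a polynomial, the number of non-zero time derivatives is its \<^const>\<open>degree\<close>. The zero
  input is not admissible: with \<open>u = 0\<close> the output satisfies
  \<open>s'' + (k1 * \<tau> + k2) * s' + k1 * s = 0\<close>, so that for every initial condition only
  \<open>k1\<close> and \<open>k1 * \<tau> + k2\<close> can be recovered from it.\<close>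

definition admissible_inputs :: "nat \<Rightarrow> (real \<Rightarrow> real) set" where
  "admissible_inputs n = {poly p |p. p \<noteq> 0 \<and> degree p = n}"

text \<open>Here \<open>y t \<theta> x0 u\<close> is the output at time \<open>t\<close>. The neighbourhood of \<open>\<theta>\<close> depends on
  \<open>\<theta>\<close> only, whereas the exceptional null set of initial conditions may depend on
  \<open>\<theta>1\<close>, \<open>\<theta>2\<close> and \<open>u\<close>. It cannot in general be chosen independently of the input: for the
  CTH-RV model, let \<open>\<theta>1 \<noteq> \<theta>2\<close> have the same \<open>\<tau>\<close> and let the matrices of the two systems share
  a real eigenvalue other than \<open>- 1 / \<tau>\<close>. Then almost every initial condition admits a non-zero constant input for
  which the outputs of \<open>\<theta>1\<close> and \<open>\<theta>2\<close> agree.\<close>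

definition structurally_locally_identifiable ::
    "'p::euclidean_space set \<Rightarrow> 'u set \<Rightarrow> (real \<Rightarrow> 'p \<Rightarrow> 'x::euclidean_space \<Rightarrow> 'u \<Rightarrow> 'y) \<Rightarrow> bool"
  where
  "structurally_locally_identifiable \<Theta> U y \<longleftrightarrow>
     (AE \<theta> in lborel. \<theta> \<in> \<Theta> \<longrightarrow>
        (\<exists>N. open N \<and> \<theta> \<in> N \<and>
           (\<forall>\<theta>1 \<in> N \<inter> \<Theta>. \<forall>\<theta>2 \<in> N \<inter> \<Theta>. \<forall>u \<in> U. AE x0 in lborel.
              (\<forall>t>0. y t \<theta>1 x0 u = y t \<theta>2 x0 u) \<longrightarrow> \<theta>1 = \<theta>2)))"

lemma linear_ode_exists:
  fixes a c :: complex and f :: "real \<Rightarrow> complex"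
  assumes "continuous_on UNIV f"
  shows "\<exists>w. w 0 = c \<and> continuous_on {0..} w \<and>
    (\<forall>t\<ge>0. (w has_vector_derivative a * w t + f t) (at t within {0..}))"
proof -
  define g where "g = (\<lambda>t. exp (t *\<^sub>R (-a)) * f t)"
  define G where "G = (\<lambda>t. integral {0..t} g)"
  define w where "w = (\<lambda>t. exp (t *\<^sub>R a) * (c + G t))"
  have g: "continuous_on {0..b} g" for b
    unfolding g_def by (intro continuous_intros continuous_on_subset[OF assms]) auto
  have G: "(G has_vector_derivative g t) (at t within {0..})" if "t \<ge> 0" for t
  proof -
    have "(G has_vector_derivative g t) (at t within {0..t+1})"
      unfolding G_def by (rule integral_has_vector_derivative[OF g]) (use that in auto)
    moreover have "at t within {0..t+1} = at t within {0..}"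
      by (rule at_within_nhd[of _ "{..<t+1}"]) auto
    ultimately show ?thesis by simp
  qed
  have w: "(w has_vector_derivative a * w t + f t) (at t within {0..})" if "t \<ge> 0" for t
  proof -
    have e: "exp (t *\<^sub>R a) * exp (t *\<^sub>R (-a)) = 1"
      by (simp flip: exp_add)
    show ?thesis
      unfolding w_def
      apply (rule has_vector_derivative_eq_rhs)
       apply (rule has_vector_derivative_mult[OF exp_scaleR_has_vector_derivative_right
           has_vector_derivative_add[OF has_vector_derivative_const G[OF that]]])
      using e by (simp add: g_def algebra_simps)
  qed
  have "continuous_on {0..} w"
    unfolding continuous_on_eq_continuous_within
    by (metis atLeast_iff has_vector_derivative_continuous w)
  moreover have "w 0 = c" by (simp add: w_def G_def)
  ultimately show ?thesis using w by blast
qed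

lemma linear_ode_exists_atLeast:
  fixes a c :: complex and f :: "real \<Rightarrow> complex"
  assumes "continuous_on {0..} f"
  shows "\<exists>w. w 0 = c \<and> continuous_on {0..} w \<and>
    (\<forall>t\<ge>0. (w has_vector_derivative a * w t + f t) (at t within {0..}))"
proof -
  have "continuous_on UNIV (\<lambda>t. f (max 0 t))"
    by (rule continuous_on_compose2[OF assms]) (auto intro!: continuous_intros)
  from linear_ode_exists[OF this, of c a] show ?thesis
    by (elim ex_forward) (auto simp: max_def)
qed

lemma cth_rv_solution_exists:
  assumes "continuous_on {0..} u"
  shows "\<exists>s v. cth_rv_solution \<theta> x0 u s v"
proof -
  obtain k1 k2 \<tau> where \<theta>: "\<theta> = (k1, k2, \<tau>)" by (cases \<theta>)
  obtain s0 v0 where x0: "x0 = (s0, v0)" by (cases x0)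
  define p where "p = k1 * \<tau> + k2"
  define m where "m = (complex_of_real p + csqrt (p\<^sup>2 - 4 * k1)) / 2"
  have "(2 * m - p)\<^sup>2 = of_real (p\<^sup>2 - 4 * k1)"
  proof -
    have "2 * m - p = csqrt (p\<^sup>2 - 4 * k1)"
      by (simp add: m_def field_simps)
    then show ?thesis by simp
  qed
  then have "4 * (m * m) = 4 * (p * m - k1)"
    by (simp add: power2_eq_square algebra_simps)
  then have m: "m * m = p * m - k1" by (rule iffD1[OF mult_left_cancel, rotated]) simp
  have "continuous_on {0..} (\<lambda>t. (k2 - m) * of_real (u t))"
    by (intro continuous_intros assms)
  from linear_ode_exists_atLeast[OF this, of "v0 - m * s0" "m - p"] obtain w :: "real \<Rightarrow> complex" where
    w: "w 0 = v0 - m * s0" "continuous_on {0..} w"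
      "\<And>t. t \<ge> 0 \<Longrightarrow>
        (w has_vector_derivative (m - p) * w t + (k2 - m) * of_real (u t)) (at t within {0..})"
    by blast
  have "continuous_on {0..} (\<lambda>t. of_real (u t) - w t)"
    by (intro continuous_intros assms w(2))
  from linear_ode_exists_atLeast[OF this, of s0 "-m"] obtain s :: "real \<Rightarrow> complex" where
    s: "s 0 = s0"
      "\<And>t. t \<ge> 0 \<Longrightarrow> (s has_vector_derivative - m * s t + (of_real (u t) - w t)) (at t within {0..})"
    by blast
  define v where "v = (\<lambda>t. w t + m * s t)"
  have s': "(s has_vector_derivative of_real (u t) - v t) (at t within {0..})" if "t \<ge> 0" for t
    using s(2)[OF that] by (simp add: v_def algebra_simps)
  have v': "(v has_vector_derivative k1 * (s t - \<tau> * v t) + k2 * (of_real (u t) - v t))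
      (at t within {0..})" if "t \<ge> 0" for t
  proof -
    have "(v has_vector_derivative
        ((m - p) * w t + (k2 - m) * of_real (u t)) + m * (of_real (u t) - v t)) (at t within {0..})"
      unfolding v_def
      by (intro has_vector_derivative_add w(3) has_vector_derivative_mult_right that)
        (use s'[OF that] in \<open>simp add: v_def\<close>)
    moreover have "((m - p) * w t + (k2 - m) * of_real (u t)) + m * (of_real (u t) - v t)
        = k1 * (s t - \<tau> * v t) + k2 * (of_real (u t) - v t)"
    proof -
      have "((m - p) * w t + (k2 - m) * of_real (u t)) + m * (of_real (u t) - v t)
        = - p * w t + k2 * of_real (u t) - m * m * s t"
        by (simp add: v_def algebra_simps)
      also have "\<dots> = k1 * (s t - \<tau> * v t) + k2 * (of_real (u t) - v t)"
        unfolding m by (simp add: v_def p_def algebra_simps)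
      finally show ?thesis .
    qed
    ultimately show ?thesis by simp
  qed
  have "cth_rv_solution \<theta> x0 u (\<lambda>t. Re (s t)) (\<lambda>t. Re (v t))"
    unfolding cth_rv_solution_def \<theta> x0 prod.case
  proof (intro conjI allI impI)
    show "Re (s 0) = s0" "Re (v 0) = v0" by (simp_all add: s(1) w(1) v_def)
  next
    fix t :: real assume t: "t \<ge> 0"
    show "((\<lambda>t. Re (s t)) has_real_derivative u t - Re (v t)) (at t within {0..})"
      using bounded_linear.has_vector_derivative[OF bounded_linear_Re s'[OF t]]
      by (simp add: has_real_derivative_iff_has_vector_derivative)
    show "((\<lambda>t. Re (v t)) has_real_derivative
        k1 * (Re (s t) - \<tau> * Re (v t)) + k2 * (u t - Re (v t))) (at t within {0..})"
      using bounded_linear.has_vector_derivative[OF bounded_linear_Re v'[OF t]]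
      by (simp add: has_real_derivative_iff_has_vector_derivative)
  qed
  then show ?thesis by blast
qed

lemma cth_rv_solution_unique:
  assumes "cth_rv_solution \<theta> x0 u s v" "cth_rv_solution \<theta> x0 u s' v'" "t \<ge> 0"
  shows "s t = s' t" "v t = v' t"
proof -
  obtain k1 k2 \<tau> where \<theta>: "\<theta> = (k1, k2, \<tau>)" by (cases \<theta>)
  obtain s0 v0 where x0: "x0 = (s0, v0)" by (cases x0)
  define p where "p = k1 * \<tau> + k2"
  define a b where "a = (\<lambda>t. s t - s' t)" and "b = (\<lambda>t. v t - v' t)"
  have ab0: "a 0 = 0" "b 0 = 0"
    using assms by (auto simp: cth_rv_solution_def \<theta> x0 a_def b_def)
  have a: "(a has_real_derivative - b r) (at r within {0..})" if "r \<ge> 0" for r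
  proof -
    have "(a has_real_derivative (u r - v r) - (u r - v' r)) (at r within {0..})"
      unfolding a_def using assms that
      by (intro DERIV_diff) (auto simp: cth_rv_solution_def \<theta> x0)
    then show ?thesis by (simp add: b_def)
  qed
  have b: "(b has_real_derivative k1 * a r - p * b r) (at r within {0..})" if "r \<ge> 0" for r
  proof -
    have "(b has_real_derivative (k1 * (s r - \<tau> * v r) + k2 * (u r - v r))
        - (k1 * (s' r - \<tau> * v' r) + k2 * (u r - v' r))) (at r within {0..})"
      unfolding b_def using assms that
      by (intro DERIV_diff) (auto simp: cth_rv_solution_def \<theta> x0)
    then show ?thesis by (simp add: a_def b_def p_def algebra_simps)
  qed
  define K where "K = \<bar>k1 - 1\<bar> + 2 * \<bar>p\<bar>"
  define E where "E = (\<lambda>r. exp (- K * r) * ((a r)\<^sup>2 + (b r)\<^sup>2))"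
  define E' where "E' = (\<lambda>r. exp (- K * r) *
      (2 * (k1 - 1) * a r * b r - 2 * p * (b r)\<^sup>2 - K * ((a r)\<^sup>2 + (b r)\<^sup>2)))"
  have E: "(E has_real_derivative E' r) (at r within {0..})" if "r \<ge> 0" for r
    unfolding E_def E'_def
    by (rule derivative_eq_intros a[OF that] b[OF that] refl)+
      (simp add: algebra_simps power2_eq_square)
  have E': "E' r \<le> 0" for r
  proof -
    have "2 * (k1 - 1) * a r * b r \<le> \<bar>k1 - 1\<bar> * (2 * \<bar>a r * b r\<bar>)"
    proof -
      have "(k1 - 1) * (a r * b r) \<le> \<bar>k1 - 1\<bar> * \<bar>a r * b r\<bar>"
        using abs_ge_self[of "(k1 - 1) * (a r * b r)"] by (simp only: abs_mult[of "k1 - 1"])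
      then have "2 * ((k1 - 1) * (a r * b r)) \<le> 2 * (\<bar>k1 - 1\<bar> * \<bar>a r * b r\<bar>)"
        by (rule mult_left_mono) simp
      then show ?thesis
        by (simp only: mult.assoc mult.left_commute[of "\<bar>k1 - 1\<bar>" 2])
    qed
    also have "\<dots> \<le> \<bar>k1 - 1\<bar> * ((a r)\<^sup>2 + (b r)\<^sup>2)"
      using sum_squares_bound[of "\<bar>a r\<bar>" "\<bar>b r\<bar>"]
      by (intro mult_left_mono) (auto simp: abs_mult)
    finally have 1: "2 * (k1 - 1) * a r * b r \<le> \<bar>k1 - 1\<bar> * ((a r)\<^sup>2 + (b r)\<^sup>2)" .
    have "- 2 * p * (b r)\<^sup>2 \<le> 2 * \<bar>p\<bar> * (b r)\<^sup>2"
      by (intro mult_right_mono) auto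
    also have "\<dots> \<le> 2 * \<bar>p\<bar> * ((a r)\<^sup>2 + (b r)\<^sup>2)"
      by (intro mult_left_mono) auto
    finally have "2 * (k1 - 1) * a r * b r - 2 * p * (b r)\<^sup>2 - K * ((a r)\<^sup>2 + (b r)\<^sup>2) \<le> 0"
      using 1 unfolding K_def distrib_right by simp
    then show ?thesis
      unfolding E'_def by (intro mult_nonneg_nonpos) simp_all
  qed
  have "E t \<le> E 0"
  proof (rule DERIV_nonpos_imp_decreasing_open[OF \<open>t \<ge> 0\<close>])
    show "\<exists>y. DERIV E r :> y \<and> y \<le> 0" if "0 < r" "r < t" for r
    proof -
      have "at r within {0..} = at r"
        by (rule at_within_interior) (use that in \<open>simp add: interior_Ici[of "-1"]\<close>)
      then show ?thesis using E[of r] E'[of r] that by auto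
    qed
    show "continuous_on {0..t} E"
      by (rule continuous_on_subset[of "{0..}"])
        (auto simp: continuous_on_eq_continuous_within intro!: DERIV_continuous[OF E])
  qed
  then have "(a t)\<^sup>2 + (b t)\<^sup>2 \<le> 0"
    by (simp add: E_def ab0 mult_le_0_iff)
  then have "a t = 0 \<and> b t = 0"
    by (simp add: sum_power2_le_zero_iff)
  then show "s t = s' t" "v t = v' t" by (auto simp: a_def b_def)
qed

lemma cth_rv_output_eq:
  assumes "cth_rv_solution \<theta> x0 u s v" "t \<ge> 0"
  shows "cth_rv_output t \<theta> x0 u = s t"
  unfolding cth_rv_output_def
  by (rule the_equality) (use assms cth_rv_solution_unique(1) in blast)+

end

theory Submission
  imports Defs
begin

text \<open>Equal outputs force equal velocities \<open>v = u - s'\<close>, hence equal accelerations. With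
  \<open>p = k1 * \<tau> + k2\<close>, subtracting the two acceleration equations gives
  \<open>(k1 - k1') * s - (p - p') * v + (k2 - k2') * u = 0\<close> for all \<open>t \<ge> 0\<close>. At \<open>t = 0\<close> this confines
  \<open>(s0, v0)\<close> to a line unless \<open>k1 = k1'\<close> and \<open>p = p'\<close>; in that case \<open>(k2 - k2') * u = 0\<close>, so
  \<open>k2 = k2'\<close> because \<open>u \<noteq> 0\<close>, and \<open>\<tau> = \<tau>'\<close> follows as long as \<open>k1 > 0\<close>.\<close>

text \<open>Covers both exceptional sets of the proof: the plane \<open>k1 = 0\<close> in parameter
  space and a line in the plane of initial conditions.\<close>

lemma AE_not_in_hyperplane:
  fixes a :: "'a::euclidean_space"
  assumes "a \<noteq> 0"
  shows "AE x in lborel. a \<bullet> x \<noteq> b"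
proof -
  have "{x. a \<bullet> x = b} \<in> null_sets lebesgue"
    using negligible_hyperplane[of a b] assms by (simp add: negligible_iff_null_sets)
  then have "{x. a \<bullet> x = b} \<in> null_sets lborel"
    by (simp add: null_sets_completion_iff borel_closed closed_hyperplane)
  then show ?thesis
    by (rule AE_I') auto
qed

text \<open>Every point of \<open>{a..}\<close>, including the endpoint \<open>a\<close>, is a limit
  point of it, so one-sided derivatives are unique. The endpoint matters: the relation between the
  two systems is later evaluated at time 0.\<close>

lemma has_real_derivative_atLeast_unique:
  fixes f g :: "real \<Rightarrow> real"
  assumes "(f has_real_derivative D) (at t within {a..})"
    and "(g has_real_derivative D') (at t within {a..})"
    and "\<And>r. r \<ge> a \<Longrightarrow> f r = g r" "t \<ge> a"
  shows "D = D'"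
proof (rule vector_derivative_unique_within)
  have "t islimpt {a..<t + 1}"
    using assms(4) by (simp add: islimpt_Ico)
  then have "t islimpt {a..}"
    by (rule islimpt_subset) auto
  then show "at t within {a..} \<noteq> bot"
    by (simp add: trivial_limit_within)
  show "(f has_vector_derivative D) (at t within {a..})"
    using assms(1) by (simp add: has_real_derivative_iff_has_vector_derivative)
  show "(f has_vector_derivative D') (at t within {a..})"
    by (rule has_vector_derivative_transform[of _ _ _ g])
      (use assms(2,3,4) in \<open>simp_all add: has_real_derivative_iff_has_vector_derivative\<close>)
qed

lemma cth_rv_output_eq_imp:
  assumes u: "continuous_on {0..} u"
    and eq: "\<forall>t>0. cth_rv_output t (k1, k2, \<tau>) (s0, v0) u = cth_rv_output t (k1', k2', \<tau>') (s0, v0) u"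
  obtains s v where "s 0 = s0" "v 0 = v0"
    "\<And>t. t \<ge> 0 \<Longrightarrow>
      (k1 - k1') * s t - ((k1 * \<tau> + k2) - (k1' * \<tau>' + k2')) * v t + (k2 - k2') * u t = 0"
proof -
  obtain s v where sol: "cth_rv_solution (k1, k2, \<tau>) (s0, v0) u s v"
    using cth_rv_solution_exists[OF u] by blast
  obtain s' v' where sol': "cth_rv_solution (k1', k2', \<tau>') (s0, v0) u s' v'"
    using cth_rv_solution_exists[OF u] by blast
  have init: "s 0 = s0" "v 0 = v0" "s' 0 = s0"
    using sol sol' by (auto simp: cth_rv_solution_def)
  \<comment> \<open>The outputs are compared only for \<open>t > 0\<close>; at \<open>t = 0\<close>
    the common initial gap \<open>s0\<close> takes over.\<close>
  have s: "s t = s' t" if "t \<ge> 0" for t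
    using eq init that cth_rv_output_eq[OF sol that] cth_rv_output_eq[OF sol' that]
    by (cases "t = 0") auto
  have v: "v t = v' t" if "t \<ge> 0" for t
  proof -
    have "u t - v t = u t - v' t"
      by (rule has_real_derivative_atLeast_unique[of s _ t 0 s'])
        (use sol sol' s that in \<open>auto simp: cth_rv_solution_def\<close>)
    then show ?thesis by simp
  qed
  show thesis
  proof (rule that[of s v, OF init(1,2)])
    fix t :: real assume t: "t \<ge> 0"
    have "k1 * (s t - \<tau> * v t) + k2 * (u t - v t) = k1' * (s' t - \<tau>' * v' t) + k2' * (u t - v' t)"
      by (rule has_real_derivative_atLeast_unique[of v _ t 0 v'])
        (use sol sol' v t in \<open>auto simp: cth_rv_solution_def\<close>)
    then show "(k1 - k1') * s t - ((k1 * \<tau> + k2) - (k1' * \<tau>' + k2')) * v t + (k2 - k2') * u t = 0"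
      using s[OF t] v[OF t] by (simp add: algebra_simps)
  qed
qed

lemma poly_nonzero_at_nonneg:
  fixes p :: "real poly"
  assumes "p \<noteq> 0"
  obtains t where "t \<ge> 0" "poly p t \<noteq> 0"
proof -
  have "\<not> {0..} \<subseteq> {t. poly p t = 0}"
    using poly_roots_finite[OF assms] infinite_Ici[of "0::real"] finite_subset by blast
  then show thesis using that by auto
qed

text \<open>The exceptional set of initial conditions is empty if \<open>k1 = k1'\<close> and
  \<open>p = p'\<close>, and otherwise a line determined by the two parameter triples and
  \<open>u 0\<close>.\<close>

lemma cth_rv_parameters_identifiable:
  assumes u: "u \<in> admissible_inputs n" and pos: "k1 > 0"
  shows "AE x0 in lborel.
    (\<forall>t>0. cth_rv_output t (k1, k2, \<tau>) x0 u = cth_rv_output t (k1', k2', \<tau>') x0 u) \<longrightarrow>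
      (k1, k2, \<tau>) = (k1', k2', \<tau>')"
proof -
  obtain q where q: "u = poly q" "q \<noteq> 0"
    using u by (auto simp: admissible_inputs_def)
  have cont: "continuous_on {0..} u"
    unfolding q by (intro continuous_intros)
  define p p' where "p = k1 * \<tau> + k2" and "p' = k1' * \<tau>' + k2'"
  show ?thesis
  proof (cases "k1 = k1' \<and> p = p'")
    case True
    \<comment> \<open>\<open>u 0\<close> may vanish, as for the input \<open>u t = t\<close>, so
      \<open>k2\<close> is recovered at a time where the input is non-zero.\<close>
    obtain t0 where t0: "t0 \<ge> 0" "u t0 \<noteq> 0"
      using poly_nonzero_at_nonneg[OF q(2)] q(1) by blast
    show ?thesis
    proof (intro AE_I2 impI)
      fix x0 :: "real \<times> real"
      assume eq: "\<forall>t>0. cth_rv_output t (k1, k2, \<tau>) x0 u = cth_rv_output t (k1', k2', \<tau>') x0 u"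
      obtain s0 v0 where x0: "x0 = (s0, v0)" by (cases x0)
      obtain s v where "(k1 - k1') * s t0 - (p - p') * v t0 + (k2 - k2') * u t0 = 0"
        using cth_rv_output_eq_imp[OF cont eq[unfolded x0], folded p_def p'_def] t0(1) by metis
      then have k2: "k2 = k2'"
        using t0(2) True by simp
      then have "k1 * \<tau> = k1' * \<tau>'"
        using True k2 by (auto simp: p_def p'_def)
      then show "(k1, k2, \<tau>) = (k1', k2', \<tau>')"
        using k2 True pos by auto
    qed
  next
    case False
    \<comment> \<open>The excluded line is the relation between the two systems at
      \<open>t = 0\<close>; the case assumption makes its normal vector non-zero. Off this line the
      outputs cannot agree, and the implication holds vacuously.\<close>
    then have "AE x0 in lborel. (k1 - k1', p' - p) \<bullet> x0 \<noteq> (k2' - k2) * u 0"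
      by (intro AE_not_in_hyperplane) (auto simp: zero_prod_def)
    then show ?thesis
    proof (rule AE_mp, intro AE_I2 impI)
      fix x0 :: "real \<times> real"
      assume eq: "\<forall>t>0. cth_rv_output t (k1, k2, \<tau>) x0 u = cth_rv_output t (k1', k2', \<tau>') x0 u"
        and ne: "(k1 - k1', p' - p) \<bullet> x0 \<noteq> (k2' - k2) * u 0"
      obtain s0 v0 where x0: "x0 = (s0, v0)" by (cases x0)
      have "(k1 - k1') * s0 - (p - p') * v0 + (k2 - k2') * u 0 = 0"
        using cth_rv_output_eq_imp[OF cont eq[unfolded x0], folded p_def p'_def]
        by (metis order_refl)
      then have "(k1 - k1', p' - p) \<bullet> x0 = (k2' - k2) * u 0"
        unfolding x0 by (simp add: algebra_simps)
      with ne show "(k1, k2, \<tau>) = (k1', k2', \<tau>')" by simp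
    qed
  qed
qed

theorem proposition1:
  shows "structurally_locally_identifiable cth_rv_parameters (\<Union>n. admissible_inputs n) cth_rv_output"
proof -
  \<comment> \<open>For \<open>k1 = 0\<close> the headway \<tau> drops out of the dynamics, so this
    null set of parameters is discarded.\<close>
  have "AE \<theta> in lborel. (1 :: real, 0 :: real, 0 :: real) \<bullet> \<theta> \<noteq> 0"
    by (rule AE_not_in_hyperplane) (simp add: zero_prod_def)
  then show ?thesis
    unfolding structurally_locally_identifiable_def
  proof (rule AE_mp, intro AE_I2 impI)
    fix \<theta> :: "real \<times> real \<times> real"
    assume \<theta>: "(1, 0, 0) \<bullet> \<theta> \<noteq> 0" "\<theta> \<in> cth_rv_parameters"
    \<comment> \<open>One half-space serves as the neighbourhood of every remaining \<theta>: the
      parameters with \<open>k1 > 0\<close> are distinguished globally, not just locally.\<close>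
    define N :: "(real \<times> real \<times> real) set" where "N = {\<theta>. fst \<theta> > 0}"
    have "open N"
      unfolding N_def by (intro open_Collect_less continuous_intros)
    moreover have "\<theta> \<in> N"
      using \<theta> by (auto simp: N_def cth_rv_parameters_def)
    moreover have "AE x0 in lborel.
        (\<forall>t>0. cth_rv_output t \<theta>1 x0 u = cth_rv_output t \<theta>2 x0 u) \<longrightarrow> \<theta>1 = \<theta>2"
      if \<theta>1: "\<theta>1 \<in> N" and u: "u \<in> (\<Union>n. admissible_inputs n)" for \<theta>1 \<theta>2 u
    proof -
      obtain k1 k2 \<tau> k1' k2' \<tau>' where \<theta>12: "\<theta>1 = (k1, k2, \<tau>)" "\<theta>2 = (k1', k2', \<tau>')"
        by (cases \<theta>1, cases \<theta>2)
      obtain n where "u \<in> admissible_inputs n" using u by blast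
      moreover have "k1 > 0" using \<theta>1 by (simp add: N_def \<theta>12)
      ultimately show ?thesis
        unfolding \<theta>12 by (rule cth_rv_parameters_identifiable)
    qed
    ultimately show "\<exists>N. open N \<and> \<theta> \<in> N \<and>
        (\<forall>\<theta>1 \<in> N \<inter> cth_rv_parameters. \<forall>\<theta>2 \<in> N \<inter> cth_rv_parameters.
          \<forall>u \<in> (\<Union>n. admissible_inputs n). AE x0 in lborel.
            (\<forall>t>0. cth_rv_output t \<theta>1 x0 u = cth_rv_output t \<theta>2 x0 u) \<longrightarrow> \<theta>1 = \<theta>2)"
      by blast
  qed
qed

end
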